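(* Define sequences $(x_i)_{i\ge1}$, $(b_i)_{i\ge1}$, $(l_i)_{i\ge1}$ by: for $1\le i\le 5$, $x_i=(0,1)$, $b_i=2$, $l_i=0$; for $i\ge 6$, $x_i=P_{i,i^2}$, $b_i=2^i$, $l_i=2^{4i^2}$. Let $Q=(q_n)$ and $x$ be the basic sequence and real number associated with $(l_i),(b_i),(x_i)$ as described in the context. Then $\lim_{n\to\infty}T_{Q,n}(x)=0$, where $T_{Q,n}(x)=q_1q_2\cdots q_n\,x \pmod 1$.
   Context: A block of length $k$ is a $k$-tuple of non-negative integers; $|B|$ denotes its length. For a positive integer $b$, define $\nu_b(j)=2^{-b}$ for $0\le j\le b-1$, $\nu_b(b)=(2^b-b)/2^b$, $\nu_b(j)=0$ for $j>b$, and $\nu_b(c_1,\dots,c_k)=\prod_{j}\nu_b(c_j)$. For positive integers $b,w$, let $P_1,\dots,P_{(b+1)^w}$ be all blocks of length $w$ with digits in $\{0,\dots,b\}$ in lexicographic order, and let $P_{b,w}$ be the concatenation of $2^{bw}\nu_b(P_1)$ copies of $P_1$, then $2^{bw}\nu_b(P_2)$ copies of $P_2$, etc., up to $P_{(b+1)^w}$ (these multiplicities are the integers $(2^b-b)^{g}$, $g$ = number of digits equal to $b$). Associated $Q$ and $x$: put $L_0=0$, $L_i=\sum_{j=1}^i l_j|x_j|$, $q_n=b_i$ for $L_{i-1}<n\le L_i$, $Q=(q_n)_{n\ge1}$; let $(E_1,E_2,\dots)$ be the infinite sequence formed by concatenating $l_1$ copies of $x_1$, then $l_2$ copies of $x_2$,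 etc.; and $x=\sum_{n\ge1}E_n/(q_1\cdots q_n)$. *)

theory Defs
  imports Complex_Main "HOL-Library.List_Lexorder"
begin

type_synonym block = "nat list"

definition nu :: "nat \<Rightarrow> nat \<Rightarrow> real" where
  "nu b j = (if j < b then 1 / 2 ^ b else if j = b then (2 ^ b - real b) / 2 ^ b else 0)"

definition nu_block :: "nat \<Rightarrow> block \<Rightarrow> real" where
  "nu_block b B = (\<Prod>c\<leftarrow>B. nu b c)"

text \<open>The order on lists is the one of \<^theory>\<open>HOL-Library.List_Lexorder\<close>, so this is the list
  of all blocks of length \<open>w\<close> with digits in \<open>{0..b}\<close> in lexicographic order.\<close>

definition blocks_lex :: "nat \<Rightarrow> nat \<Rightarrow> block list" where
  "blocks_lex b w = sorted_list_of_set {B. length B = w \<and> set B \<subseteq> {0..b}}"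

text \<open>The floor below does not round anything on the blocks it is applied to:
  see \<open>of_nat_multiplicity\<close>.\<close>

definition multiplicity_P :: "nat \<Rightarrow> nat \<Rightarrow> block \<Rightarrow> nat" where
  "multiplicity_P b w B = nat \<lfloor>2 ^ (b * w) * nu_block b B\<rfloor>"

definition P_block :: "nat \<Rightarrow> nat \<Rightarrow> block" where
  "P_block b w = concat (map (\<lambda>B. concat (replicate (multiplicity_P b w B) B)) (blocks_lex b w))"

lemma scaled_nu_block:
  assumes "set B \<subseteq> {0..b}"
  shows "2 ^ (b * length B) * nu_block b B = real ((2 ^ b - b) ^ length (filter (\<lambda>c. c = b) B))"
  using assms
proof (induction B)
  case Nil
  then show ?case by (simp add: nu_block_def)
next
  case (Cons c B)
  have le: "b \<le> 2 ^ b" by (simp add: less_imp_le)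
  have 1: "2 ^ b * nu b c = real (if c = b then 2 ^ b - b else 1)"
    using Cons.prems le by (auto simp: nu_def of_nat_diff)
  have "2 ^ (b * length (c # B)) * nu_block b (c # B) =
      (2 ^ b * nu b c) * (2 ^ (b * length B) * nu_block b B)"
    by (simp add: nu_block_def power_add)
  also have "\<dots> = real (if c = b then 2 ^ b - b else 1)
      * real ((2 ^ b - b) ^ length (filter (\<lambda>c. c = b) B))"
    using Cons 1 by simp
  finally show ?case by auto
qed

lemma multiplicity_P_eq:
  assumes "length B = w" "set B \<subseteq> {0..b}"
  shows "multiplicity_P b w B = (2 ^ b - b) ^ length (filter (\<lambda>c. c = b) B)"
  using scaled_nu_block[OF assms(2)] assms(1) unfolding multiplicity_P_def
  by (metis floor_of_nat nat_int)

lemma of_nat_multiplicity: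
  assumes "length B = w" "set B \<subseteq> {0..b}"
  shows "real (multiplicity_P b w B) = 2 ^ (b * w) * nu_block b B"
  using scaled_nu_block[OF assms(2)] multiplicity_P_eq[OF assms] assms(1) by simp

text \<open>Below, all sequences are indexed from 1; their values at 0 are irrelevant.\<close>

definition L_sum :: "(nat \<Rightarrow> nat) \<Rightarrow> (nat \<Rightarrow> block) \<Rightarrow> nat \<Rightarrow> nat" where
  "L_sum l X i = (\<Sum>j=1..i. l j * length (X j))"

definition stage :: "(nat \<Rightarrow> nat) \<Rightarrow> (nat \<Rightarrow> block) \<Rightarrow> nat \<Rightarrow> nat" where
  "stage l X n = (THE i. 1 \<le> i \<and> L_sum l X (i - 1) < n \<and> n \<le> L_sum l X i)"

definition assoc_Q :: "(nat \<Rightarrow> nat) \<Rightarrow> (nat \<Rightarrow> nat) \<Rightarrow> (nat \<Rightarrow> block) \<Rightarrow> nat \<Rightarrow> nat" where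
  "assoc_Q l b X n = b (stage l X n)"

definition concat_upto :: "(nat \<Rightarrow> nat) \<Rightarrow> (nat \<Rightarrow> block) \<Rightarrow> nat \<Rightarrow> block" where
  "concat_upto l X i = concat (map (\<lambda>j. concat (replicate (l j) (X j))) [1..<Suc i])"

text \<open>The infinite concatenation is read off its finite initial segments, which have length
  \<open>L_sum l X i\<close>; list positions start at 0.\<close>

definition assoc_E :: "(nat \<Rightarrow> nat) \<Rightarrow> (nat \<Rightarrow> block) \<Rightarrow> nat \<Rightarrow> nat" where
  "assoc_E l X n = concat_upto l X (stage l X n) ! (n - 1)"

lemma length_concat_upto: "length (concat_upto l X i) = L_sum l X i"
  by (induction i) (simp_all add: concat_upto_def L_sum_def length_concat sum_list_replicate)

definition assoc_x :: "(nat \<Rightarrow> nat) \<Rightarrow> (nat \<Rightarrow> nat) \<Rightarrow> (nat \<Rightarrow> block) \<Rightarrow> real" where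
  "assoc_x l b X =
     (\<Sum>n. real (assoc_E l X (Suc n)) / (\<Prod>m=1..Suc n. real (assoc_Q l b X m)))"

definition T_map :: "(nat \<Rightarrow> nat) \<Rightarrow> nat \<Rightarrow> real \<Rightarrow> real" where
  "T_map Q n x = frac ((\<Prod>m=1..n. real (Q m)) * x)"

end

theory Submission
  imports Defs
begin

text \<open>Up to an integer, \<open>q\<^sub>1\<cdots>q\<^sub>n x\<close> is the tail
  \<open>\<Sum>\<^sub>k E\<^sub>n\<^sub>+\<^sub>k / (q\<^sub>n\<^sub>+\<^sub>1\<cdots>q\<^sub>n\<^sub>+\<^sub>k)\<close>. Since all \<open>q\<^sub>m \<ge> 2\<close>, a bound \<open>E\<^sub>m / q\<^sub>m \<le> \<epsilon>\<close> for \<open>m > n\<close>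
  bounds this tail by the geometric series \<open>2 \<epsilon>\<close>. At stage \<open>i\<close> the digits are at most \<open>i\<close> whereas
  the bases are \<open>2\<^sup>i\<close>, so \<open>E\<^sub>m / q\<^sub>m \<longlonglongrightarrow> 0\<close>.\<close>

text \<open>Going from \<open>n\<close> to \<open>Suc n\<close> multiplies the integer already
  obtained by \<open>q (Suc n)\<close> and adds the digit \<open>E (Suc n)\<close>. This is the part
  of the scaled series that \<open>frac\<close> discards.\<close>

lemma cantor_partial_sum_scaled_Ints:
  fixes q E :: "nat \<Rightarrow> nat"
  assumes "\<And>m. 1 \<le> m \<Longrightarrow> 0 < q m"
  shows "(\<Prod>m=1..n. real (q m)) * (\<Sum>k<n. real (E (Suc k)) / (\<Prod>m=1..Suc k. real (q m))) \<in> \<int>"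
proof (induction n)
  case 0
  then show ?case by simp
next
  case (Suc n)
  define p where "p n = (\<Prod>m=1..n. real (q m))" for n
  define S where "S n = (\<Sum>k<n. real (E (Suc k)) / p (Suc k))" for n
  have "p (Suc n) \<noteq> 0"
    unfolding p_def by (rule less_imp_neq[OF prod_pos, symmetric]) (use assms in auto)
  then have "p (Suc n) * S (Suc n) = p (Suc n) * S n + real (E (Suc n))"
    by (simp add: S_def distrib_left)
  also have "p (Suc n) * S n = real (q (Suc n)) * (p n * S n)"
    by (simp add: p_def mult_ac)
  finally have "p (Suc n) * S (Suc n) = real (q (Suc n)) * (p n * S n) + real (E (Suc n))" .
  moreover have "p n * S n \<in> \<int>"
    using Suc unfolding S_def p_def .
  ultimately have "p (Suc n) * S (Suc n) \<in> \<int>"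
    by simp
  then show ?case unfolding S_def p_def .
qed

lemma cantor_prod_growth:
  fixes q :: "nat \<Rightarrow> nat"
  assumes "\<And>m. 1 \<le> m \<Longrightarrow> 2 \<le> q m"
  shows "2 ^ k * (\<Prod>m=1..n. real (q m)) \<le> (\<Prod>m=1..k + n. real (q m))"
proof (induction k)
  case (Suc k)
  have "2 ^ Suc k * (\<Prod>m=1..n. real (q m)) \<le> (\<Prod>m=1..k + n. real (q m)) * 2"
    using Suc by simp
  also have "\<dots> \<le> (\<Prod>m=1..k + n. real (q m)) * real (q (Suc (k + n)))"
    using assms[of "Suc (k + n)"] by (intro mult_left_mono prod_nonneg) auto
  finally show ?case by simp
qed simp

text \<open>After cancelling the first \<open>n\<close> factors, the last base divides the digit,
  which gives a ratio at most \<open>e\<close>; the remaining \<open>k\<close> bases contribute at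
  most \<open>(1 / 2) ^ k\<close>.\<close>

lemma cantor_term_scaled_le:
  fixes q E :: "nat \<Rightarrow> nat"
  assumes q: "\<And>m. 1 \<le> m \<Longrightarrow> 2 \<le> q m"
    and e: "\<And>m. n < m \<Longrightarrow> real (E m) / real (q m) \<le> e"
  shows "(\<Prod>m=1..n. real (q m)) * (real (E (Suc (k + n))) / (\<Prod>m=1..Suc (k + n). real (q m)))
    \<le> e * (1 / 2) ^ k"
proof -
  define p where "p n = (\<Prod>m=1..n. real (q m))" for n
  have pos: "0 < p n" for n
    unfolding p_def by (rule prod_pos) (use q in fastforce)
  have growth: "2 ^ k * p n \<le> p (k + n)"
    using cantor_prod_growth[of q k n] q unfolding p_def by blast
  have "p n * (real (E (Suc (k + n))) / p (Suc (k + n)))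
      = (real (E (Suc (k + n))) / real (q (Suc (k + n)))) * (p n / p (k + n))"
    by (simp add: p_def mult_ac)
  also have "\<dots> \<le> e * (1 / 2) ^ k"
  proof (rule mult_mono)
    show "p n / p (k + n) \<le> (1 / 2) ^ k"
      using growth pos[of "k + n"] by (simp add: field_simps)
    \<comment> \<open>The sign of \<open>e\<close> is implied: \<open>e\<close> bounds the
      nonnegative ratio at index \<open>Suc n\<close>.\<close>
    show "0 \<le> e"
      using order_trans[OF _ e[of "Suc n"]] by simp
  qed (use e pos[THEN less_imp_le] in auto)
  finally show ?thesis unfolding p_def .
qed

lemma T_map_cantor_series_tendsto_0:
  fixes q E :: "nat \<Rightarrow> nat"
  assumes q: "\<And>m. 1 \<le> m \<Longrightarrow> 2 \<le> q m"
    and lim: "(\<lambda>m. real (E m) / real (q m)) \<longlonglongrightarrow> 0"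
  shows "(\<lambda>n. T_map q n (\<Sum>k. real (E (Suc k)) / (\<Prod>m=1..Suc k. real (q m)))) \<longlonglongrightarrow> 0"
proof -
  define p where "p n = (\<Prod>m=1..n. real (q m))" for n
  define a where "a k = real (E (Suc k)) / p (Suc k)" for k
  have pnn: "0 \<le> p n" for n
    unfolding p_def by (rule prod_nonneg) simp
  have ann: "0 \<le> a k" for k
    unfolding a_def using pnn by simp
  have geom: "summable (\<lambda>k. e * (1 / 2) ^ k)" "(\<Sum>k. e * (1 / 2) ^ k) = 2 * e" for e :: real
    by (auto intro!: summable_mult summable_geometric simp: suminf_mult summable_geometric suminf_geometric)
  have le: "p n * a (k + n) \<le> e * (1 / 2) ^ k"
    if "\<And>m. n < m \<Longrightarrow> real (E m) / real (q m) \<le> e" for n e k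
    using cantor_term_scaled_le[of q n E e k] q that unfolding p_def a_def by blast
  \<comment> \<open>Convergence of the whole series comes from \<open>le\<close> at
    \<open>n = 0\<close>, where \<open>p 0 = 1\<close>: the ratios converge, hence are bounded by
    some \<open>C\<close>, and the series is dominated by a geometric one.\<close>
  obtain C where C: "\<And>m. norm (real (E m) / real (q m)) \<le> C"
    using convergent_imp_Bseq[OF convergentI[OF lim]] unfolding Bseq_def by auto
  have a_le: "a k \<le> C * (1 / 2) ^ k" for k
    using le[of 0 C k] C by (simp add: p_def)
  have sum_a: "summable a"
    by (rule summable_comparison_test'[OF geom(1)[of C], of 0]) (use a_le ann in simp)
  \<comment> \<open>The condition \<open>e < 1 / 2\<close> keeps the tail
    \<open>R \<le> 2 * e\<close> below 1, so that \<open>frac\<close> returns exactly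
    \<open>R\<close>.\<close>
  have T_le: "T_map q n (suminf a) \<le> 2 * e"
    if small: "\<And>m. n < m \<Longrightarrow> real (E m) / real (q m) \<le> e" and "e < 1 / 2" for n e
  proof -
    define R where "R = (\<Sum>k. p n * a (k + n))"
    have sum_shift: "summable (\<lambda>k. a (k + n))"
      using sum_a by (rule summable_ignore_initial_segment)
    have "p n * suminf a = R + p n * (\<Sum>k<n. a k)"
      unfolding R_def using suminf_split_initial_segment[OF sum_a, of n]
      by (simp add: suminf_mult[OF sum_shift] distrib_left)
    moreover have "p n * (\<Sum>k<n. a k) \<in> \<int>"
      unfolding p_def a_def
      by (rule cantor_partial_sum_scaled_Ints) (use q in fastforce)
    moreover have "0 \<le> R"
      unfolding R_def using sum_shift ann pnn by (intro suminf_nonneg summable_mult) auto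
    moreover have "R \<le> (\<Sum>k. e * (1 / 2) ^ k)"
      unfolding R_def using sum_shift le[OF small] geom(1) by (intro suminf_le summable_mult) auto
    ultimately have "frac (p n * suminf a) = R" and "R \<le> 2 * e"
      using \<open>e < 1 / 2\<close> geom(2)[of e] by (simp_all add: frac_unique_iff)
    then show ?thesis
      unfolding T_map_def p_def by simp
  qed
  have "(\<lambda>n. T_map q n (suminf a)) \<longlonglongrightarrow> 0"
  proof (rule LIMSEQ_I)
    fix r :: real
    assume "0 < r"
    \<comment> \<open>The entry \<open>r / 3\<close> gives \<open>2 * e < r\<close>, and
      \<open>1 / 3\<close> gives the \<open>e < 1 / 2\<close> required by
      \<open>T_le\<close>.\<close>
    define e where "e = min (r / 3) (1 / 3)"
    have "0 < e" using \<open>0 < r\<close> by (simp add: e_def)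
    from LIMSEQ_D[OF lim this] obtain N where
      N: "\<And>m. N \<le> m \<Longrightarrow> norm (real (E m) / real (q m) - 0) < e" by blast
    have "norm (T_map q n (suminf a) - 0) < r" if "N \<le> n" for n
    proof -
      have "T_map q n (suminf a) \<le> 2 * e"
      proof (rule T_le)
        show "real (E m) / real (q m) \<le> e" if "n < m" for m
          using N[of m] \<open>N \<le> n\<close> that by simp
        show "e < 1 / 2" by (simp add: e_def min_less_iff_disj)
      qed
      also have "\<dots> < r" using \<open>0 < r\<close> by (simp add: e_def)
      finally show ?thesis by (simp add: T_map_def)
    qed
    then show "\<exists>N. \<forall>n\<ge>N. norm (T_map q n (suminf a) - 0) < r" by blast
  qed
  then show ?thesis unfolding a_def p_def .
qed

lemma L_sum_Suc: "L_sum l X (Suc i) = L_sum l X i + l (Suc i) * length (X (Suc i))"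
  by (simp add: L_sum_def)

lemma L_sum_mono: "i \<le> j \<Longrightarrow> L_sum l X i \<le> L_sum l X j"
  unfolding L_sum_def by (intro sum_mono2) auto

text \<open>The description in \<open>stage\<close> denotes something because the least
  \<open>i\<close> with \<open>n \<le> L_sum l X i\<close> satisfies it, and because monotonicity of
  \<open>L_sum\<close> makes the intervals between consecutive values disjoint.\<close>

lemma stage_bounds:
  assumes unbounded: "\<exists>i. n \<le> L_sum l X i" and "1 \<le> n"
  shows "1 \<le> stage l X n" "L_sum l X (stage l X n - 1) < n" "n \<le> L_sum l X (stage l X n)"
proof -
  let ?P = "\<lambda>i. 1 \<le> i \<and> L_sum l X (i - 1) < n \<and> n \<le> L_sum l X i"
  define i where "i = (LEAST i. n \<le> L_sum l X i)"
  have i: "n \<le> L_sum l X i"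
    unfolding i_def using unbounded by (rule LeastI_ex)
  have "i \<noteq> 0"
    using i \<open>1 \<le> n\<close> by (intro notI) (simp add: L_sum_def)
  then have "L_sum l X (i - 1) < n"
    using not_less_Least[of "i - 1" "\<lambda>i. n \<le> L_sum l X i"] unfolding i_def[symmetric] by simp
  with i \<open>i \<noteq> 0\<close> have Pi: "?P i" by simp
  have "j = i" if "?P j" for j
  proof (rule ccontr)
    assume "j \<noteq> i"
    then consider "j \<le> i - 1" | "i \<le> j - 1" by linarith
    then show False
      using L_sum_mono[of j "i - 1" l X] L_sum_mono[of i "j - 1" l X] Pi that by cases auto
  qed
  with Pi have "?P (stage l X n)"
    unfolding stage_def by (rule theI)
  then show "1 \<le> stage l X n" "L_sum l X (stage l X n - 1) < n" "n \<le> L_sum l X (stage l X n)"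
    by auto
qed

text \<open>Position \<open>n - 1\<close> lies beyond everything contributed by earlier stages, so
  it falls among the copies of the current block.\<close>

lemma assoc_E_in_block:
  assumes "\<exists>i. n \<le> L_sum l X i" "1 \<le> n"
  shows "assoc_E l X n \<in> set (X (stage l X n))"
proof -
  note bounds = stage_bounds[OF assms]
  obtain i where i: "stage l X n = Suc i"
    using bounds(1) by (cases "stage l X n") auto
  let ?B = "concat (replicate (l (Suc i)) (X (Suc i)))"
  have split: "concat_upto l X (Suc i) = concat_upto l X i @ ?B"
    by (simp add: concat_upto_def)
  have lt: "L_sum l X i < n" and le: "n \<le> L_sum l X (Suc i)"
    using bounds unfolding i by simp_all
  have "length (concat_upto l X (Suc i)) = L_sum l X i + length ?B"
    unfolding split by (simp add: length_concat_upto)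
  then have "n - 1 - L_sum l X i < length ?B"
    using lt le unfolding length_concat_upto by linarith
  then have "?B ! (n - 1 - L_sum l X i) \<in> set ?B"
    by (rule nth_mem)
  moreover have "assoc_E l X n = ?B ! (n - 1 - L_sum l X i)"
    using lt unfolding assoc_E_def i split by (auto simp: nth_append length_concat_upto)
  ultimately have "assoc_E l X n \<in> set ?B" by simp
  then show ?thesis unfolding i by (auto split: if_splits)
qed

lemma set_blocks_lex: "set (blocks_lex b w) = {B. length B = w \<and> set B \<subseteq> {0..b}}"
proof -
  have "finite {B. set B \<subseteq> {0..b} \<and> length B = w}"
    by (rule finite_lists_length_eq) simp
  then show ?thesis
    unfolding blocks_lex_def by (subst set_sorted_list_of_set) (auto simp: conj_commute)
qed

lemma set_P_block_subset: "set (P_block b w) \<subseteq> {0..b}"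
  by (auto simp: P_block_def set_blocks_lex split: if_splits)

text \<open>The zero block has no digit equal to \<open>b\<close>, so its multiplicity is
  \<open>(2 ^ b - b) ^ 0 = 1\<close>. Nonemptiness is what makes \<open>L_sum\<close> unbounded,
  giving every position a stage.\<close>

lemma P_block_nonempty:
  assumes "0 < b" "0 < w"
  shows "P_block b w \<noteq> []"
proof -
  have B: "replicate w 0 \<in> set (blocks_lex b w)"
    by (auto simp: set_blocks_lex)
  then have "multiplicity_P b w (replicate w 0) = 1"
    using assms by (subst multiplicity_P_eq) (auto simp: set_blocks_lex)
  then have "0 \<in> set (P_block b w)"
    using B assms unfolding P_block_def by (auto intro!: bexI[of _ "replicate w 0"])
  then show ?thesis by auto
qed

theorem theorem4:
  fixes X :: "nat \<Rightarrow> block" and b l :: "nat \<Rightarrow> nat"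
  assumes "\<And>i. 1 \<le> i \<Longrightarrow> i \<le> 5 \<Longrightarrow> X i = [0, 1] \<and> b i = 2 \<and> l i = 0"
    and "\<And>i. 6 \<le> i \<Longrightarrow> X i = P_block i (i ^ 2) \<and> b i = 2 ^ i \<and> l i = 2 ^ (4 * i ^ 2)"
  shows "(\<lambda>n. T_map (assoc_Q l b X) n (assoc_x l b X)) \<longlonglongrightarrow> 0"
proof -
  define s where "s = stage l X"
  \<comment> \<open>The first five stages are empty, so position 1 already belongs to stage 6 or
    later.\<close>
  have L5: "L_sum l X 5 = 0"
    unfolding L_sum_def using assms(1) by simp
  \<comment> \<open>Each stage after the fifth adds at least one digit; this crude growth
    suffices.\<close>
  have "n \<le> L_sum l X (n + 5)" for n
  proof (induction n)
    case (Suc n)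
    have "0 < l (Suc (n + 5)) * length (X (Suc (n + 5)))"
      using assms(2)[of "Suc (n + 5)"] P_block_nonempty[of "Suc (n + 5)" "(Suc (n + 5))\<^sup>2"] by simp
    then show ?case
      using Suc L_sum_Suc[of l X "n + 5"] by (simp only: add_Suc)
  qed simp
  then have unbounded: "\<exists>i. n \<le> L_sum l X i" for n by blast
  \<comment> \<open>Used with \<open>K = 5\<close> to reach the main formulas for \<open>X\<close>
    and \<open>b\<close>, and with arbitrary \<open>K\<close> to get \<open>s\<close> tending to
    infinity.\<close>
  have s_gt: "K < s n" if "L_sum l X K < n" for K n
  proof (rule ccontr)
    assume "\<not> K < s n"
    then have "L_sum l X (s n) \<le> L_sum l X K" by (intro L_sum_mono) simp
    moreover have "n \<le> L_sum l X (s n)"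
      using stage_bounds(3)[OF unbounded, of n] that unfolding s_def by simp
    ultimately show False using that by simp
  qed
  have s_ge: "6 \<le> s n" if "1 \<le> n" for n
    using s_gt[of 5 n] L5 that by simp
  have Q_eq: "assoc_Q l b X n = 2 ^ s n" if "1 \<le> n" for n
    using assms(2)[OF s_ge[OF that]] unfolding assoc_Q_def s_def by blast
  have E_le: "assoc_E l X n \<le> s n" if "1 \<le> n" for n
  proof -
    have "assoc_E l X n \<in> set (X (s n))"
      using assoc_E_in_block[OF unbounded that] unfolding s_def .
    also have "X (s n) = P_block (s n) ((s n)\<^sup>2)"
      using assms(2)[OF s_ge[OF that]] by blast
    also have "set \<dots> \<subseteq> {0..s n}" by (rule set_P_block_subset)
    finally show ?thesis by simp
  qed
  have "filterlim s at_top sequentially"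
    unfolding filterlim_at_top
  proof
    fix K
    show "\<forall>\<^sub>F n in sequentially. K \<le> s n"
      using eventually_gt_at_top[of "L_sum l X K"] by eventually_elim (rule less_imp_le[OF s_gt])
  qed
  moreover have "(\<lambda>k. real k * (1 / 2) ^ k) \<longlonglongrightarrow> 0"
    by (rule powser_times_n_limit_0) simp
  ultimately have s_lim: "(\<lambda>n. real (s n) * (1 / 2) ^ s n) \<longlonglongrightarrow> 0"
    by (rule filterlim_compose[rotated])
  have "(\<lambda>n. real (assoc_E l X n) / real (assoc_Q l b X n)) \<longlonglongrightarrow> 0"
  \<comment> \<open>The ratio is at most \<open>s n / 2 ^ s n\<close> for \<open>n \<ge> 1\<close>;
    at \<open>n = 0\<close> no stage exists, hence the eventual bound.\<close>
  proof (rule tendsto_sandwich[OF _ _ tendsto_const s_lim])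
    show "\<forall>\<^sub>F n in sequentially. real (assoc_E l X n) / real (assoc_Q l b X n) \<le> real (s n) * (1 / 2) ^ s n"
      using eventually_ge_at_top[of 1]
      by eventually_elim (simp add: Q_eq E_le power_one_over divide_simps)
  qed simp
  moreover have "2 \<le> assoc_Q l b X m" if "1 \<le> m" for m
    using s_ge[OF that] power_increasing[of 1 "s m" "2 :: nat"] Q_eq[OF that] by simp
  ultimately show ?thesis
    unfolding assoc_x_def by (intro T_map_cantor_series_tendsto_0) auto
qed

end
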